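(* For every odd prime $p$, $C(2p,0)=(-1)^{\frac{p-1}{2}}\,p$.
   Context: $C(n,x)$ is the minimal polynomial over $\mathbb Q$ of $2\cos(\pi/n)$, $n\in\mathbb N$. *)

theory Defs
  imports Complex_Main "HOL-Algebra.Algebraic_Closure_Type"
begin

abbreviation real_ring :: "real ring"
  where "real_ring \<equiv> ring_of_type_algebra"

text \<open>
  The minimal polynomial \<open>C(n, x)\<close> of \<open>2 cos(\<pi>/n)\<close> over the rationals: the monic irreducible
  polynomial over \<open>\<rat>\<close> (as a subfield of \<open>\<real>\<close>) having this number as a root. Polynomials are
  coefficient lists with the leading coefficient first, and the coefficients are rational elements
  of \<^typ>\<open>real\<close>. The definition is of interest only for \<open>n \<ge> 1\<close>.
\<close>

definition C :: "nat \<Rightarrow> real list"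
  where "C n = ring.Irr real_ring \<rat> (2 * cos (pi / real n))"

text \<open>
  Together with the following facts, the library shows that \<open>ring.Irr real_ring \<rat> x\<close> is
  well defined for every algebraic number \<open>x\<close>.
\<close>

lemma field_real_ring: "field real_ring"
  by (rule field_from_type_algebra)

lemma subfield_Rats: "subfield \<rat> real_ring"
proof -
  interpret R: field real_ring by (rule field_real_ring)
  have carr: "carrier real_ring = UNIV" and zero: "\<zero>\<^bsub>real_ring\<^esub> = 0" and one: "\<one>\<^bsub>real_ring\<^esub> = 1"
    and add: "x \<oplus>\<^bsub>real_ring\<^esub> y = x + y" and mult: "x \<otimes>\<^bsub>real_ring\<^esub> y = x * y" for x y
    by (simp_all add: ring_of_type_algebra_def)
  have minus: "\<ominus>\<^bsub>real_ring\<^esub> x = - x" for x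
    by (rule R.minus_equality) (simp_all add: carr zero add)
  have inv: "inv\<^bsub>real_ring\<^esub> x = inverse x" if "x \<noteq> 0" for x
    using that by (intro R.comm_inv_char) (simp_all add: carr one mult)
  show ?thesis
  proof (rule R.subfieldI')
    show "subring \<rat> real_ring"
      by (rule R.subringI) (simp_all add: carr one add mult minus)
    show "inv\<^bsub>real_ring\<^esub> k \<in> \<rat>" if "k \<in> \<rat> - {\<zero>\<^bsub>real_ring\<^esub>}" for k
      using that by (simp add: zero inv)
  qed
qed

end

theory Submission
  imports Defs
begin

text \<open>
  Let \<open>V\<^sub>n\<close> be the monic integer polynomial with \<open>V\<^sub>n (2 cos t) = 2 cos (n t)\<close>. For an odd prime
  \<open>p\<close>, the number \<open>2 cos (\<pi>/2p)\<close> is a nonzero root of \<open>V\<^sub>p\<close>, hence a root of \<open>V\<^sub>p / x\<close>. The identity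
  \<open>V\<^sub>p' = p U\<^bsub>p-1\<^esub>\<close> shows that \<open>p\<close> divides every coefficient of \<open>V\<^sub>p\<close> except the leading one, and
  that the linear coefficient is \<open>p U\<^bsub>p-1\<^esub>(0) = (-1)\<^bsup>(p-1)/2\<^esup> p\<close>. So \<open>V\<^sub>p / x\<close> is an Eisenstein
  polynomial at \<open>p\<close>, hence irreducible over \<open>\<rat>\<close> and equal to the minimal polynomial.
\<close>

subsection \<open>Eisenstein's criterion over the rationals\<close>

text \<open>Let \<open>i\<close> be the first index at which \<open>p\<close> does not divide the
  coefficient of \<open>g\<close>. Modulo \<open>p\<close> only \<open>g_i * h_0\<close> survives in
  the convolution for \<open>coeff f i\<close>, so \<open>i\<close> is at least the degree of
  \<open>f\<close>, yet it is at most that of \<open>g\<close>.\<close>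

lemma Eisenstein_factor_aux:
  fixes f g h :: "'a :: idom poly"
  assumes p: "prime_elem p" and f: "f = g * h" and lead: "\<not> p dvd Polynomial.lead_coeff f"
    and dvd: "\<And>i. i < Polynomial.degree f \<Longrightarrow> p dvd Polynomial.coeff f i"
    and h0: "\<not> p dvd Polynomial.coeff h 0"
  shows "Polynomial.degree h = 0"
proof -
  have "f \<noteq> 0" using lead by auto
  hence nz: "g \<noteq> 0" "h \<noteq> 0" using f by auto
  hence deg: "Polynomial.degree f = Polynomial.degree g + Polynomial.degree h"
    by (simp add: f degree_mult_eq)
  have leadg: "\<not> p dvd Polynomial.lead_coeff g"
    using lead by (auto simp: f Polynomial.lead_coeff_mult)
  define i where "i = (LEAST i. \<not> p dvd Polynomial.coeff g i)"
  have gi: "\<not> p dvd Polynomial.coeff g i"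
    unfolding i_def by (rule LeastI) (rule leadg)
  have less: "p dvd Polynomial.coeff g j" if "j < i" for j
    using not_less_Least[of j "\<lambda>i. \<not> p dvd Polynomial.coeff g i"] that unfolding i_def by auto
  have le: "i \<le> Polynomial.degree g"
    unfolding i_def by (rule Least_le) (rule leadg)
  have "\<not> p dvd Polynomial.coeff f i"
  proof
    assume "p dvd Polynomial.coeff f i"
    moreover have "Polynomial.coeff f i =
        (\<Sum>j<i. Polynomial.coeff g j * Polynomial.coeff h (i - j)) +
        Polynomial.coeff g i * Polynomial.coeff h 0"
      by (simp add: f Polynomial.coeff_mult flip: lessThan_Suc_atMost)
    moreover have "p dvd (\<Sum>j<i. Polynomial.coeff g j * Polynomial.coeff h (i - j))"
      by (intro dvd_sum dvd_mult2 less) auto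
    ultimately have "p dvd Polynomial.coeff g i * Polynomial.coeff h 0"
      by (metis dvd_add_right_iff)
    thus False using p gi h0 by (simp add: prime_elem_dvd_mult_iff)
  qed
  hence "Polynomial.degree f \<le> i" using dvd[of i] by linarith
  thus ?thesis using le deg by simp
qed

text \<open>If \<open>p\<close> divided both constant terms, \<open>p\<^sup>2\<close> would divide
  their product; so the previous lemma applies to \<open>g * h\<close> or to
  \<open>h * g\<close>.\<close>

lemma Eisenstein_factor:
  fixes f g h :: "'a :: idom poly"
  assumes p: "prime_elem p" and f: "f = g * h" and lead: "\<not> p dvd Polynomial.lead_coeff f"
    and dvd: "\<And>i. i < Polynomial.degree f \<Longrightarrow> p dvd Polynomial.coeff f i"
    and f0: "\<not> p\<^sup>2 dvd Polynomial.coeff f 0"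
  shows "Polynomial.degree g = 0 \<or> Polynomial.degree h = 0"
proof -
  have "\<not> p dvd Polynomial.coeff g 0 \<or> \<not> p dvd Polynomial.coeff h 0"
    using f0 by (auto simp: f coeff_mult_0 power2_eq_square intro: mult_dvd_mono)
  thus ?thesis
    using Eisenstein_factor_aux[OF p f lead dvd]
      Eisenstein_factor_aux[OF p _ lead dvd, of h g] f by (auto simp: mult.commute)
qed

lemma map_poly_of_int_mult:
  "map_poly of_int (f * g) = (map_poly of_int f * map_poly of_int g :: 'a :: comm_ring_1 poly)"
  by (intro poly_eqI) (simp add: coeff_map_poly Polynomial.coeff_mult)

text \<open>Rationality is a membership condition, not a type, so that real polynomials are covered
  directly. The induction multiplies in one denominator per coefficient.\<close>

lemma rat_poly_clear_denominators:
  fixes q :: "'a :: field_char_0 poly"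
  assumes "\<And>i. Polynomial.coeff q i \<in> \<rat>"
  obtains c g where "c \<noteq> 0" "smult (of_int c) q = map_poly of_int g"
proof -
  have "\<exists>c g. c \<noteq> 0 \<and> smult (of_int c) q = map_poly of_int g" using assms
  proof (induction q)
    case 0
    show ?case by (rule exI[of _ 1], rule exI[of _ 0]) simp
  next
    case (pCons a q)
    have "Polynomial.coeff q i \<in> \<rat>" for i
      using pCons.prems[of "Suc i"] by simp
    then obtain c g where cg: "c \<noteq> 0" "smult (of_int c) q = map_poly of_int g"
      using pCons.IH by blast
    have "a \<in> \<rat>" using pCons.prems[of 0] by simp
    then obtain m n where mn: "n > 0" "a = of_int m / of_int n"
      by (elim Rats_cases')
    have "smult (of_int (c * n)) (pCons a q) = map_poly of_int (pCons (c * m) (smult n g))"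
      using mn by (simp add: map_poly_pCons map_poly_smult mult.commute flip: cg(2))
    thus ?case using cg(1) mn(1) by (metis less_irrefl mult_eq_0_iff)
  qed
  thus ?thesis using that by blast
qed

text \<open>Gauss's lemma: clearing denominators gives \<open>c * f = g * h\<close> over the
  integers, and multiplicativity of the content lets \<open>c\<close> cancel once \<open>g\<close>
  and \<open>h\<close> are replaced by their primitive parts.\<close>

lemma Gauss_factorization:
  fixes P Q :: "'a :: field_char_0 poly" and f :: "int poly"
  assumes f: "map_poly of_int f = P * Q" "f \<noteq> 0"
    and P: "\<And>i. Polynomial.coeff P i \<in> \<rat>" and Q: "\<And>i. Polynomial.coeff Q i \<in> \<rat>"
  obtains g h where "f = g * h" "Polynomial.degree g = Polynomial.degree P"
    "Polynomial.degree h = Polynomial.degree Q"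
proof -
  obtain a g where g: "a \<noteq> 0" "smult (of_int a) P = map_poly of_int g"
    using rat_poly_clear_denominators[of P] P by blast
  obtain b h where h: "b \<noteq> 0" "smult (of_int b) Q = map_poly of_int h"
    using rat_poly_clear_denominators[of Q] Q by blast
  define c where "c = a * b"
  have c: "c \<noteq> 0" using g h by (simp add: c_def)
  have "map_poly of_int (smult c f) = (map_poly of_int (g * h) :: 'a poly)"
    by (simp add: map_poly_smult f c_def map_poly_of_int_mult mult_ac flip: g h)
  hence "of_int (Polynomial.coeff (smult c f) i) = (of_int (Polynomial.coeff (g * h) i) :: 'a)" for i
    by (metis coeff_map_poly of_int_0)
  hence *: "smult c f = g * h"
    by (intro poly_eqI) (simp only: of_int_eq_iff)
  have cont: "\<bar>c\<bar> * content f = content g * content h"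
    using arg_cong[OF *, of content] by (simp add: content_mult)
  have "smult c f = smult (content g * content h) (primitive_part g * primitive_part h)"
    by (metis * content_times_primitive_part mult_smult_left mult_smult_right smult_smult)
  \<comment> \<open>Here \<open>\<bar>c\<bar> = c * sgn c\<close>; the sign is absorbed into the
    first factor.\<close>
  also have "\<dots> = smult c (smult (sgn c * content f) (primitive_part g) * primitive_part h)"
    by (simp add: sgn_mult_abs flip: cont) (simp add: abs_sgn mult_ac)
  finally have "f = smult (sgn c * content f) (primitive_part g) * primitive_part h"
    using c by (simp add: poly_eq_iff)
  moreover have "Polynomial.degree g = Polynomial.degree P"
    using arg_cong[OF g(2), of Polynomial.degree] g(1) by (simp add: degree_map_poly)
  moreover have "Polynomial.degree h = Polynomial.degree Q"
    using arg_cong[OF h(2), of Polynomial.degree] h(1) by (simp add: degree_map_poly)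
  ultimately show ?thesis
    using that[of "smult (sgn c * content f) (primitive_part g)" "primitive_part h"] c f(2)
    by (simp add: sgn_0_0)
qed

subsection \<open>Polynomials expressing multiple angles\<close>

text \<open>The Chebyshev polynomials of the first kind, rescaled to
  \<open>2 * T\<^sub>n(x/2)\<close>.\<close>

fun vieta_lucas :: "nat \<Rightarrow> int poly" where
  "vieta_lucas 0 = [:2:]"
| "vieta_lucas (Suc 0) = [:0, 1:]"
| "vieta_lucas (Suc (Suc n)) = [:0, 1:] * vieta_lucas (Suc n) - vieta_lucas n"

text \<open>The Chebyshev polynomials of the second kind, rescaled to
  \<open>U\<^sub>n(x/2)\<close>.\<close>

fun vieta_fibonacci :: "nat \<Rightarrow> int poly" where
  "vieta_fibonacci 0 = 1"
| "vieta_fibonacci (Suc 0) = [:0, 1:]"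
| "vieta_fibonacci (Suc (Suc n)) = [:0, 1:] * vieta_fibonacci (Suc n) - vieta_fibonacci n"

lemma poly_vieta_lucas_cos:
  "poly (map_poly of_int (vieta_lucas n)) (2 * cos t) = 2 * cos (real n * t)"
proof (induction n rule: vieta_lucas.induct)
  case (3 n)
  have diff: "map_poly of_int (f - g) = (map_poly of_int f - map_poly of_int g :: real poly)"
    for f g :: "int poly"
    by (intro poly_eqI) (simp add: coeff_map_poly)
  have "cos (real (Suc (Suc n)) * t) + cos (real n * t) = 2 * cos t * cos (real (Suc n) * t)"
    using cos_plus_cos[of "real (Suc (Suc n)) * t" "real n * t"]
    by (simp add: algebra_simps add_divide_distrib)
  thus ?case using 3 by (simp add: diff map_poly_pCons algebra_simps)
qed (simp_all add: map_poly_pCons)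

lemma vieta_lucas_coeffs:
  assumes "n > 0"
  shows "Polynomial.coeff (vieta_lucas n) n = 1 \<and>
    (\<forall>i>n. Polynomial.coeff (vieta_lucas n) i = 0)"
  using assms
proof (induction n rule: vieta_lucas.induct)
  case (3 n)
  have "Polynomial.coeff (vieta_lucas n) i = 0" if "i > n" for i
    \<comment> \<open>The induction hypothesis for \<open>n\<close> needs \<open>n > 0\<close>; for
      \<open>n = 0\<close> the subtracted polynomial is the constant 2.\<close>
    using 3 that by (cases "n = 0") (auto simp: Polynomial.coeff_pCons split: nat.splits)
  with 3 show ?case by (auto simp: Polynomial.coeff_pCons split: nat.splits)
qed (auto simp: Polynomial.coeff_pCons split: nat.splits)

text \<open>Both sides obey the same recurrence. This absorbs the extra term that the product rule
  produces in the derivative formula below.\<close>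

lemma vieta_lucas_plus_fibonacci:
  "vieta_lucas (Suc (Suc n)) + vieta_fibonacci n = vieta_fibonacci (Suc (Suc n))"
proof (induction n rule: vieta_fibonacci.induct)
  case (3 n)
  have "vieta_lucas (Suc (Suc (Suc (Suc n)))) + vieta_fibonacci (Suc (Suc n)) =
      [:0, 1:] * (vieta_lucas (Suc (Suc (Suc n))) + vieta_fibonacci (Suc n)) -
      (vieta_lucas (Suc (Suc n)) + vieta_fibonacci n)"
    by (simp add: algebra_simps)
  thus ?case unfolding 3 by simp
qed (simp_all add: one_pCons)

lemma pderiv_vieta_lucas:
  "pderiv (vieta_lucas (Suc n)) = of_nat (Suc n) * vieta_fibonacci n"
proof (induction n rule: vieta_fibonacci.induct)
  case (3 n)
  \<comment> \<open>Writing \<open>- k * w\<close> as \<open>w - (k + 1) * w\<close> frees one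
    \<open>w\<close> to join \<open>v\<close>, as the preceding lemma requires.\<close>
  have ring: "v + x * (of_nat (Suc k) * u) - of_nat k * w = (v + w) + of_nat (Suc k) * (x * u - w)"
    for v x u w :: "int poly" and k
    by (simp add: algebra_simps)
  have "pderiv (vieta_lucas (Suc (Suc (Suc n)))) =
      vieta_lucas (Suc (Suc n)) + [:0, 1:] * pderiv (vieta_lucas (Suc (Suc n))) -
      pderiv (vieta_lucas (Suc n))"
    by (subst vieta_lucas.simps, subst pderiv_diff, subst pderiv_mult)
      (simp add: pderiv_pCons del: vieta_lucas.simps)
  also have "\<dots> = vieta_lucas (Suc (Suc n)) + [:0, 1:] *
      (of_nat (Suc (Suc n)) * vieta_fibonacci (Suc n)) - of_nat (Suc n) * vieta_fibonacci n"
    unfolding 3 ..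
  also have "\<dots> = (vieta_lucas (Suc (Suc n)) + vieta_fibonacci n) +
      of_nat (Suc (Suc n)) * ([:0, 1:] * vieta_fibonacci (Suc n) - vieta_fibonacci n)"
    by (rule ring)
  also have "\<dots> = of_nat (Suc (Suc (Suc n))) * vieta_fibonacci (Suc (Suc n))"
    unfolding vieta_lucas_plus_fibonacci vieta_fibonacci.simps(3)[symmetric]
    by (simp only: of_nat_Suc ring_distribs mult_1_left)
  finally show ?case .
qed (simp_all add: pderiv_pCons one_pCons)

text \<open>The derivative formula read coefficientwise. If \<open>Suc n\<close> is prime and
  \<open>i < n\<close>, it is coprime to \<open>Suc i\<close> and so divides the coefficient on the
  left.\<close>

lemma coeff_vieta_lucas:
  "int (Suc i) * Polynomial.coeff (vieta_lucas (Suc n)) (Suc i) =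
    int (Suc n) * Polynomial.coeff (vieta_fibonacci n) i"
proof -
  have "Polynomial.coeff (pderiv (vieta_lucas (Suc n))) i =
      Polynomial.coeff (smult (int (Suc n)) (vieta_fibonacci n)) i"
    by (simp only: pderiv_vieta_lucas of_nat_poly) simp
  thus ?thesis by (simp add: coeff_pderiv)
qed

lemma vieta_fibonacci_even_coeff_0: "Polynomial.coeff (vieta_fibonacci (2 * m)) 0 = (- 1) ^ m"
  by (induction m) simp_all

lemma vieta_lucas_odd_coeff_0: "Polynomial.coeff (vieta_lucas (Suc (2 * m))) 0 = 0"
  by (induction m) simp_all

subsection \<open>The minimal polynomial\<close>

text \<open>
  HOL-Algebra lists start with the leading coefficient, whereas \<^const>\<open>Poly\<close> starts with the
  constant one; hence the \<^const>\<open>rev\<close>.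
\<close>

lemma eval_real_ring: "ring.eval real_ring xs x = poly (Poly (rev xs)) x"
proof -
  interpret R: field real_ring by (rule field_real_ring)
  have pow: "x [^]\<^bsub>real_ring\<^esub> n = x ^ n" for x and n :: nat
    by (induction n) (simp_all add: ring_of_type_algebra_def)
  show ?thesis
    by (induction xs)
      (simp_all add: pow Poly_append poly_monom, simp_all add: ring_of_type_algebra_def)
qed

lemma carrier_Rats_poly:
  "xs \<in> carrier (univ_poly real_ring \<rat>) \<longleftrightarrow> set xs \<subseteq> \<rat> \<and> (xs \<noteq> [] \<longrightarrow> hd xs \<noteq> 0)"
  by (auto simp: univ_poly_def polynomial_def ring_of_type_algebra_def)

lemma coeff_Poly_Rats:
  assumes "set xs \<subseteq> \<rat>"
  shows "Polynomial.coeff (Poly xs) i \<in> \<rat>"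
  using assms by (auto simp: nth_default_def)

text \<open>The minimal polynomial divides \<open>f\<close>, which vanishes at \<open>x\<close>. It
  is not constant, so irreducibility makes the cofactor constant, and that constant is 1 because
  both polynomials are monic.\<close>

lemma Irr_Rats_eq:
  fixes f :: "real poly"
  assumes rat: "\<And>i. Polynomial.coeff f i \<in> \<rat>" and monic: "Polynomial.lead_coeff f = 1"
    and root: "poly f x = 0"
    and irred: "\<And>P Q. f = P * Q \<Longrightarrow> (\<And>i. Polynomial.coeff P i \<in> \<rat>) \<Longrightarrow>
      (\<And>i. Polynomial.coeff Q i \<in> \<rat>) \<Longrightarrow> Polynomial.degree P = 0 \<or> Polynomial.degree Q = 0"
  shows "Poly (rev (ring.Irr real_ring \<rat> x)) = f"
proof -
  interpret R: field real_ring by (rule field_real_ring)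
  have [simp]: "carrier real_ring = UNIV" "\<zero>\<^bsub>real_ring\<^esub> = 0" "\<one>\<^bsub>real_ring\<^esub> = 1"
    and mult: "a \<otimes>\<^bsub>real_ring\<^esub> b = a * b" for a b
    by (simp_all add: ring_of_type_algebra_def)
  have [simp]: "x \<in> carrier real_ring" for x by simp
  define l where "l = rev (coeffs f)"
  have "f \<noteq> 0" using monic by auto
  hence "hd l \<noteq> 0" "l \<noteq> []"
    by (auto simp: l_def hd_rev last_coeffs_eq_coeff_degree)
  moreover have "set l \<subseteq> \<rat>" using rat by (auto simp: l_def coeffs_def)
  ultimately have l: "l \<in> carrier (univ_poly real_ring \<rat>)" "l \<noteq> []"
    by (simp_all add: carrier_Rats_poly)
  have evl: "R.eval l y = poly f y" for y by (simp add: eval_real_ring l_def)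
  have alg: "(R.algebraic over \<rat>) x"
    by (rule R.algebraicI[OF l]) (simp add: evl root)
  define I where "I = R.Irr \<rat> x"
  note IrrE = R.IrrE[OF subfield_Rats _ alg, folded I_def, simplified]
  have "I pdivides\<^bsub>real_ring\<^esub> l"
    unfolding I_def by (rule R.Irr_minimal[OF subfield_Rats _ alg l(1)]) (simp_all add: evl root)
  then obtain r where r: "r \<in> carrier (univ_poly real_ring \<rat>)" "l = R.poly_mult I r"
    using R.pdivides_iff_shell[OF subfield_Rats IrrE(1) l(1)]
    by (auto simp: factor_def univ_poly_mult)
  define P Q where "P = Poly (rev I)" and "Q = Poly (rev r)"
  \<comment> \<open>The list product is carried over to the type \<open>poly\<close> through values:
    real polynomials that agree everywhere are equal.\<close>
  have "poly f y = poly (P * Q) y" for y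
    using R.eval_poly_mult[of I r y]
    by (simp add: P_def Q_def mult flip: eval_real_ring evl r(2))
  hence f: "f = P * Q" by (simp add: poly_eq_poly_eq_iff[symmetric] fun_eq_iff)
  have degs: "Polynomial.degree P = 0 \<or> Polynomial.degree Q = 0"
    by (rule irred[OF f]) (use IrrE(1) r(1) in
        \<open>auto simp: P_def Q_def carrier_Rats_poly simp del: coeff_Poly_eq intro!: coeff_Poly_Rats\<close>)
  have "I \<noteq> []" using r l(2) by auto
  then obtain I' where I': "I = 1 # I'" using IrrE(3) by (cases I) auto
  have P: "P = Poly (rev I') + Polynomial.monom 1 (length I')"
    by (simp add: P_def I' Poly_append)
  have coeffP: "Polynomial.coeff P (length I') = 1"
    unfolding P by (simp add: nth_default_def)
  have degP: "Polynomial.degree P = length I'"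
  proof (rule antisym)
    show "Polynomial.degree P \<le> length I'"
      unfolding P by (rule degree_le) (simp add: nth_default_def)
    show "length I' \<le> Polynomial.degree P"
      by (rule le_degree) (simp add: coeffP)
  qed
  \<comment> \<open>A constant monic \<open>P\<close> would be 1, which does not vanish at
    \<open>x\<close>.\<close>
  have "Polynomial.degree P \<noteq> 0"
    using IrrE(4) I' by (auto simp: degP mult)
  hence "Polynomial.degree Q = 0" using degs by simp
  then obtain c where c: "Q = [:c:]" by (rule degree_eq_zeroE)
  have "Polynomial.lead_coeff P = 1" by (simp add: degP coeffP)
  hence "c = 1" using monic by (cases "c = 0") (simp_all add: f c)
  thus ?thesis using f c by (simp add: P_def I_def)
qed

theorem corollary1:
  fixes p :: nat
  assumes "prime p" and "odd p"
  shows "ring.eval real_ring (C (2 * p)) 0 = (-1) ^ ((p - 1) div 2) * real p"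
proof -
  obtain m where m: "p = Suc (2 * m)" using assms(2) by (metis oddE Suc_eq_plus1)
  have "m > 0" using m assms(1) by (cases m) auto
  have prime: "prime_elem (int p)" using assms(1) by simp
  \<comment> \<open>\<open>f\<close> is the Eisenstein polynomial, \<open>vieta_lucas p\<close>
    divided by \<open>x\<close>; its coefficients are shifted down by one.\<close>
  obtain f where f: "vieta_lucas p = pCons 0 f"
    using vieta_lucas_odd_coeff_0[of m] by (cases "vieta_lucas p") (auto simp: m)
  have coeff: "int (Suc i) * Polynomial.coeff f i =
      int p * Polynomial.coeff (vieta_fibonacci (2 * m)) i" for i
    using coeff_vieta_lucas[of i "2 * m"] f by (simp add: m)
  have f0: "Polynomial.coeff f 0 = (- 1) ^ m * int p"
    using coeff[of 0] by (simp add: vieta_fibonacci_even_coeff_0)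
  have lead: "Polynomial.coeff f (2 * m) = 1"
    using vieta_lucas_coeffs[of p] unfolding f by (auto simp: m)
  have big: "Polynomial.coeff f i = 0" if "i > 2 * m" for i
    using vieta_lucas_coeffs[of p] that unfolding f by (auto simp: m dest: spec[of _ "Suc i"])
  have deg: "Polynomial.degree f = 2 * m"
    by (intro antisym degree_le le_degree) (simp_all add: lead big)
  have dvd: "int p dvd Polynomial.coeff f i" if "i < Polynomial.degree f" for i
  proof -
    \<comment> \<open>Indeed \<open>0 < Suc i < p\<close>, as \<open>f\<close> has degree
      \<open>p - 1\<close>.\<close>
    have "\<not> int p dvd int (Suc i)"
      using that unfolding deg m int_dvd_int_iff by (auto dest: dvd_imp_le)
    thus ?thesis using coeff[of i] prime by (metis dvd_triv_left prime_elem_dvd_mult_iff)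
  qed
  have f0': "\<not> (int p)\<^sup>2 dvd Polynomial.coeff f 0"
    using assms(1) by (cases "even m") (auto simp: f0 power2_eq_square)
  define F where "F = (map_poly of_int f :: real poly)"
  define t where "t = pi / real (2 * p)"
  have "real p * t = pi / 2" using assms(2) by (cases "p = 0") (simp_all add: t_def)
  hence "poly (map_poly of_int (vieta_lucas p)) (2 * cos t) = 0"
    by (simp only: poly_vieta_lucas_cos cos_pi_half mult_zero_right)
  \<comment> \<open>The root is nonzero, so it survives removal of the factor
    \<open>x\<close>.\<close>
  moreover have "cos t > 0"
    using m \<open>m > 0\<close> by (intro cos_gt_zero) (auto simp: t_def field_simps)
  ultimately have root: "poly F (2 * cos t) = 0"
    by (simp add: f F_def map_poly_pCons)
  have "Poly (rev (ring.Irr real_ring \<rat> (2 * cos t))) = F"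
  proof (rule Irr_Rats_eq[OF _ _ root])
    show "Polynomial.lead_coeff F = 1"
      by (simp add: F_def degree_map_poly coeff_map_poly deg lead)
    fix P Q :: "real poly"
    assume PQ: "F = P * Q" "\<And>i. Polynomial.coeff P i \<in> \<rat>" "\<And>i. Polynomial.coeff Q i \<in> \<rat>"
    have "f \<noteq> 0" using deg \<open>m > 0\<close> by auto
    then obtain g h where "f = g * h" "Polynomial.degree g = Polynomial.degree P"
        "Polynomial.degree h = Polynomial.degree Q"
      using Gauss_factorization[of f P Q] PQ unfolding F_def by blast
    moreover have "\<not> int p dvd Polynomial.lead_coeff f"
      using assms(1) by (auto simp: deg lead)
    ultimately show "Polynomial.degree P = 0 \<or> Polynomial.degree Q = 0"
      using Eisenstein_factor[OF prime, of f g h] dvd f0' by auto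
  qed (simp add: F_def coeff_map_poly)
  hence "ring.eval real_ring (C (2 * p)) 0 = poly F 0"
    by (simp add: eval_real_ring C_def t_def)
  also have "\<dots> = (- 1) ^ m * real p"
    by (simp add: poly_0_coeff_0 F_def coeff_map_poly f0)
  finally show ?thesis by (simp add: m)
qed

end
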